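(* Let $x\in\mathcal X$ be fixed. Consider the primal problem $$\min_{\pi\in\mathcal D}\ \sum_{k=1}^{\hat K}\int_{\mathcal S}G(s,x)\,d\pi(\hat s_k,s)\tag{P}$$ and the problem $$\max_{\beta\in\mathbb R^{\hat K+1},\ \beta_{\hat K+1}\ge0}\ \sum_{k=1}^{\hat K}\hat w_k\beta_k-\rho\beta_{\hat K+1}\quad\text{s.t.}\quad\beta_k-\beta_{\hat K+1}d_{\mathrm{BW}}^2(\mathcal N(\hat s_k),\mathcal N(s))\le G(s,x)\quad\forall s\in\mathcal S,\ \forall k\in\{1,\dots,\hat K\}.\tag{D}$$ Then the optimal values of (P) and (D) are equal.
   Context: Optimal values are understood as infimum (for P) and supremum (for D). $\mathcal S=\Theta\times\Xi\subseteq\mathbb R^n\times\mathbb S^n_{\hat\delta}$ is compact, where $\hat\delta>0$ and $\mathbb S^n_{\hat\delta}$ is the set of symmetric matrices $Q\succeq\hat\delta I$. For $s=(m,Q)\in\mathcal S$, $\mathcal N(s)$ is the Gaussian law on $\mathbb R^n$ with mean $m$, covariance $Q$; for $s_i=(m_i,Q_i)$, $d_{\mathrm{BW}}^2(\mathcal N(s_1),\mathcal N(s_2))=\|m_1-m_2\|^2+\operatorname{tr}(Q_1+Q_2-2(Q_1^{1/2}Q_2Q_1^{1/2})^{1/2})$. The nominal distribution is $\sum_{k=1}^{\hat K}\hat w_k\mathcal N(\hat s_k)$ with distinct $\hat s_k\in\mathcal S$, $\hat w_k\ge0$, $\sum_k\hat w_k=1$; $\hat{\mathcal S}=\{\hat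 s_1,\dots,\hat s_{\hat K}\}$. $\mathcal X\subset\mathbb R^n$ is compact, $b\in\mathbb R$, and $\rho\ge0$ is the Wasserstein radius. For $s=(m,Q)$, $G(s,x)=\Phi\bigl((b-m^\top x)/\sqrt{x^\top Qx}\bigr)$ if $x\ne0$ ($\Phi$ the standard normal CDF), $G(s,0)=1$ if $b\ge0$, and $G(s,0)=0$ if $b<0$. $\mathcal D$ is the set of Borel probability measures $\pi$ on $\hat{\mathcal S}\times\mathcal S$ with $\pi(\{\hat s_k\}\times\mathcal S)=\hat w_k$ for all $k$ and $\int d_{\mathrm{BW}}^2(\mathcal N(\hat s),\mathcal N(s))\,d\pi(\hat s,s)\le\rho$; $d\pi(\hat s_k,s)$ denotes integration over $s$ against $\pi(\{\hat s_k\}\times\cdot)$. *)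

theory Defs
  imports "HOL-Probability.Probability"
begin

definition psd :: "real ^ 'n ^ 'n \<Rightarrow> bool" where
  "psd A \<longleftrightarrow> transpose A = A \<and> (\<forall>v. 0 \<le> v \<bullet> (A *v v))"

definition sym_mats_ge :: "real \<Rightarrow> (real ^ 'n ^ 'n) set" where
  "sym_mats_ge \<delta> = {Q. transpose Q = Q \<and> psd (Q - \<delta> *\<^sub>R mat 1)}"

(* Only meaningful on positive semidefinite matrices, where the square root exists and is unique. *)
definition psd_sqrt :: "real ^ 'n ^ 'n \<Rightarrow> real ^ 'n ^ 'n" where
  "psd_sqrt A = (THE B. psd B \<and> B ** B = A)"

(* A nondegenerate Gaussian law N(s) is identified with its parameter s = (mean, covariance). *)
type_synonym 'n gauss_param = "(real ^ 'n) \<times> (real ^ 'n ^ 'n)"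

(* Squared Bures-Wasserstein distance between N(s1) and N(s2), by its closed form. *)
definition bw_sq :: "'n::finite gauss_param \<Rightarrow> 'n gauss_param \<Rightarrow> real" where
  "bw_sq s1 s2 = (case s1 of (m1, Q1) \<Rightarrow> case s2 of (m2, Q2) \<Rightarrow>
     (norm (m1 - m2))\<^sup>2
     + trace (Q1 + Q2 - 2 *\<^sub>R psd_sqrt (psd_sqrt Q1 ** Q2 ** psd_sqrt Q1)))"

definition std_normal_cdf :: "real \<Rightarrow> real" where
  "std_normal_cdf = cdf std_normal_distribution"

definition G :: "real \<Rightarrow> 'n::finite gauss_param \<Rightarrow> real ^ 'n \<Rightarrow> real" where
  "G b s x = (case s of (m, Q) \<Rightarrow>
     if x \<noteq> 0 then std_normal_cdf ((b - m \<bullet> x) / sqrt (x \<bullet> (Q *v x)))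
     else if b \<ge> 0 then 1 else 0)"

(* Integrability is automatic for compact S; it is stated because the Bochner integral
   of a non-integrable function is 0 by convention. *)
definition couplings ::
  "'n::finite gauss_param set \<Rightarrow> nat \<Rightarrow> (nat \<Rightarrow> 'n gauss_param) \<Rightarrow> (nat \<Rightarrow> real) \<Rightarrow> real
   \<Rightarrow> ('n gauss_param \<times> 'n gauss_param) measure set" where
  "couplings S K sh w \<rho> = {\<pi>. prob_space \<pi>
     \<and> sets \<pi> = sets (restrict_space borel (sh ` {1..K} \<times> S))
     \<and> (\<forall>k\<in>{1..K}. measure \<pi> ({sh k} \<times> S) = w k)
     \<and> integrable \<pi> (\<lambda>(s', s). bw_sq s' s)
     \<and> (\<integral>(s', s). bw_sq s' s \<partial>\<pi>) \<le> \<rho>}"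

(* The finite measure \<pi>({s'} \<times> _) on S. *)
definition slice ::
  "('n::finite gauss_param \<times> 'n gauss_param) measure \<Rightarrow> 'n gauss_param set \<Rightarrow> 'n gauss_param
   \<Rightarrow> 'n gauss_param measure" where
  "slice \<pi> S s' = distr (restrict_space \<pi> ({s'} \<times> S)) (restrict_space borel S) snd"

definition primal_obj ::
  "'n::finite gauss_param set \<Rightarrow> nat \<Rightarrow> (nat \<Rightarrow> 'n gauss_param) \<Rightarrow> real \<Rightarrow> real ^ 'n
   \<Rightarrow> ('n gauss_param \<times> 'n gauss_param) measure \<Rightarrow> real" where
  "primal_obj S K sh b x \<pi> = (\<Sum>k=1..K. \<integral>s. G b s x \<partial>slice \<pi> S (sh k))"

definition dual_feasible ::
  "'n::finite gauss_param set \<Rightarrow> nat \<Rightarrow> (nat \<Rightarrow> 'n gauss_param) \<Rightarrow> real \<Rightarrow> real ^ 'n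
   \<Rightarrow> (nat \<Rightarrow> real) set" where
  "dual_feasible S K sh b x = {\<beta> \<in> {1..K+1} \<rightarrow>\<^sub>E UNIV. \<beta> (K+1) \<ge> 0
     \<and> (\<forall>k\<in>{1..K}. \<forall>s\<in>S. \<beta> k - \<beta> (K+1) * bw_sq (sh k) s \<le> G b s x)}"

definition dual_obj :: "nat \<Rightarrow> (nat \<Rightarrow> real) \<Rightarrow> real \<Rightarrow> (nat \<Rightarrow> real) \<Rightarrow> real" where
  "dual_obj K w \<rho> \<beta> = (\<Sum>k=1..K. w k * \<beta> k) - \<rho> * \<beta> (K+1)"

end

theory Submission
  imports Defs
begin

text \<open>
  Only two numbers of a coupling matter for the primal problem, its transport cost and its objective
  value, so the duality is a statement about a set in the plane. Moving the nominal component \<open>k\<close> to a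
  single place \<open>f k\<close>, for each \<open>k\<close>, produces the pairs collected in \<open>moments\<close>, and mixtures of such
  assignments produce all pairs in their convex hull (\<open>coupling_of_moment\<close>).

  The cost and the objective are continuous in the parameter, and the parameter set is compact, so this
  hull is compact (\<open>compact_moments\<close>). If \<open>p\<close> lies strictly below the primal value, the hull misses the
  closed quadrant of pairs with cost at most \<open>\<rho>\<close> and objective at most \<open>p\<close>. Strict separation of a compact
  and a closed convex set yields a multiplier for the budget constraint
  (\<open>lagrange_multiplier_exists\<close>); the separating line is not vertical, because leaving every component
  in place costs nothing and is therefore within the budget, even for \<open>\<rho> = 0\<close>. Minimising the penalised
  objective separately for each \<open>k\<close> turns the multiplier into a dual feasible point of value at least
  \<open>p\<close> (\<open>dual_point_of_multiplier\<close>). The opposite inequality is obtained by integrating the dual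
  constraint (\<open>weak_duality\<close>), for arbitrary couplings.

  The analytic input is the continuity of the Bures--Wasserstein cost, hence of the square root on
  positive definite matrices. The square root exists by a contraction argument
  (\<open>pos_def_root_exists\<close>), and one Lipschitz estimate (\<open>psd_root_lipschitz\<close>) supplies its uniqueness
  and continuity.
\<close>

section \<open>Matrix products and the Frobenius inner product\<close>

lemma bounded_bilinear_matrix_mult:
  "bounded_bilinear ((**) :: real^'n^'m \<Rightarrow> real^'k^'n \<Rightarrow> real^'k^'m)"
  unfolding bilinear_conv_bounded_bilinear [symmetric] bilinear_def
  by (auto intro!: linearI simp: vec_eq_iff matrix_matrix_mult_def sum.distrib algebra_simps
      sum_distrib_left)

interpretation matrix_mult: bounded_bilinear "(**) :: real^'n^'m \<Rightarrow> real^'k^'n \<Rightarrow> real^'k^'m"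
  by (rule bounded_bilinear_matrix_mult)

lemma linear_transpose: "linear (transpose :: real^'n^'m \<Rightarrow> real^'m^'n)"
  by (auto intro!: linearI simp: vec_eq_iff transpose_def)

lemma transpose_add: "transpose (A + B) = transpose A + transpose (B :: real^'n^'m)"
  and transpose_diff: "transpose (A - B) = transpose A - transpose (B :: real^'n^'m)"
  by (simp_all add: linear_add linear_diff linear_transpose)

lemma inner_transpose: "transpose A \<bullet> transpose B = A \<bullet> (B :: real^'n^'m)"
  unfolding inner_vec_def transpose_def by (simp, rule sum.swap)

lemma norm_transpose: "norm (transpose (A :: real^'n^'m)) = norm A"
  by (simp add: norm_eq_sqrt_inner inner_transpose)

lemma matrix_mult_row: "(D ** C) $ i = transpose C *v ((D :: real^'n^'m) $ i)"
  by (simp add: vec_eq_iff matrix_matrix_mult_def matrix_vector_mult_def transpose_def mult.commute)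

section \<open>Square roots of positive definite matrices\<close>

text \<open>
  The constant \<open>\<alpha>\<close> is carried along instead of strict positivity on nonzero vectors:
  it is the modulus that the estimates below consume.
\<close>

definition pos_def :: "real ^ 'n ^ 'n \<Rightarrow> bool" where
  "pos_def A \<longleftrightarrow> transpose A = A \<and> (\<exists>\<alpha>>0. \<forall>v. \<alpha> * (v \<bullet> v) \<le> v \<bullet> (A *v v))"

lemma pos_defI:
  assumes "transpose A = A" and "\<alpha> > 0" and "\<And>v. \<alpha> * (v \<bullet> v) \<le> v \<bullet> (A *v v)"
  shows "pos_def A"
  using assms unfolding pos_def_def by blast

lemma pos_def_imp_psd:
  assumes "pos_def A"
  shows "psd A"
proof -
  obtain \<alpha> where "\<alpha> > 0" and sym: "transpose A = A" and \<alpha>: "\<And>v. \<alpha> * (v \<bullet> v) \<le> v \<bullet> (A *v v)"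
    using assms unfolding pos_def_def by blast
  have "0 \<le> v \<bullet> (A *v v)" for v
  proof -
    have "0 \<le> \<alpha> * (v \<bullet> v)"
      using \<open>\<alpha> > 0\<close> by simp
    then show ?thesis
      using \<alpha> [of v] by linarith
  qed
  then show ?thesis
    using sym by (simp add: psd_def)
qed

lemma inner_symmetric_matrix:
  assumes "transpose A = (A :: real^'n^'n)"
  shows "(A *v u) \<bullet> v = u \<bullet> (A *v v)"
  by (metis assms dot_lmul_matrix vector_transpose_matrix)

text \<open>
  With \<open>D = B - C\<close> one has \<open>B D + D C = B\<^sup>2 - C\<^sup>2\<close>. Pairing this identity with \<open>D\<close> in the
  Frobenius inner product, the first term is at least \<open>\<beta>\<close> times the square of the norm of \<open>D\<close>
  and the second is nonnegative. This single estimate gives both the uniqueness of the square root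
  and its continuity.
\<close>

lemma psd_root_lipschitz:
  fixes B C :: "real ^ 'n ^ 'n"
  assumes symB: "transpose B = B" and B: "\<And>v. \<beta> * (v \<bullet> v) \<le> v \<bullet> (B *v v)"
    and C: "psd C"
  shows "\<beta> * norm (B - C) \<le> norm (B ** B - C ** C)"
proof -
  define D where "D = B - C"
  have symC: "transpose C = C"
    using C by (simp add: psd_def)
  have symD: "transpose D = D"
    by (simp add: D_def transpose_diff symB symC)
  have row: "D \<bullet> (D ** E) = (\<Sum>i\<in>UNIV. D $ i \<bullet> (E *v D $ i))" if "transpose E = E" for E
    unfolding inner_vec_def [of D] matrix_mult_row that ..
  have "\<beta> * (norm D)\<^sup>2 = (\<Sum>i\<in>UNIV. \<beta> * (D $ i \<bullet> D $ i))"
    by (simp add: power2_norm_eq_inner inner_vec_def [of D] sum_distrib_left)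
  also have "\<dots> \<le> D \<bullet> (D ** B)"
    unfolding row [OF symB] by (intro sum_mono B)
  also have "D \<bullet> (D ** B) = D \<bullet> (B ** D)"
    using inner_transpose [of D "D ** B"] by (simp add: matrix_transpose_mul symD symB)
  also have "\<dots> \<le> D \<bullet> (B ** D) + D \<bullet> (D ** C)"
    unfolding row [OF symC] using C by (simp add: psd_def sum_nonneg)
  also have "\<dots> = D \<bullet> (B ** B - C ** C)"
    by (simp add: D_def matrix_mult.diff_left matrix_mult.diff_right inner_right_distrib [symmetric])
  also have "\<dots> \<le> norm D * norm (B ** B - C ** C)"
    by (rule norm_cauchy_schwarz)
  finally have "norm D * (\<beta> * norm D) \<le> norm D * norm (B ** B - C ** C)"
    by (simp add: power2_eq_square algebra_simps)
  then show ?thesis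
    unfolding D_def [symmetric]
    by (cases "norm D = 0") (auto simp: mult_le_cancel_left)
qed

text \<open>
  The norm of a matrix is the Frobenius norm, while the factor is bounded in operator norm. The
  two norms have to be mixed in this way because a matrix below the identity can have a large
  Frobenius norm.
\<close>

lemma norm_matrix_mult_le:
  fixes D Y :: "real ^ 'n ^ 'n"
  assumes Y: "\<And>v. norm (transpose Y *v v) \<le> r * norm v" and "r \<ge> 0"
  shows "norm (D ** Y) \<le> r * norm D"
proof -
  have "(norm (D ** Y))\<^sup>2 = (\<Sum>i\<in>UNIV. (norm (transpose Y *v (D $ i)))\<^sup>2)"
    by (simp add: power2_norm_eq_inner inner_vec_def [of "D ** Y"] matrix_mult_row del: transpose_matrix_vector)
  also have "\<dots> \<le> (\<Sum>i\<in>UNIV. (r * norm (D $ i))\<^sup>2)"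
    by (intro sum_mono power_mono Y norm_ge_zero)
  also have "\<dots> = (r * norm D)\<^sup>2"
    by (simp add: power_mult_distrib power2_norm_eq_inner inner_vec_def [of D] sum_distrib_left)
  finally show ?thesis
    by (rule power2_le_imp_le) (use \<open>r \<ge> 0\<close> in simp)
qed

text \<open>
  A bound on the quadratic form of a positive semidefinite matrix bounds its operator norm.
\<close>

lemma psd_norm_le:
  fixes C :: "real ^ 'n ^ 'n"
  assumes C: "psd C" and c: "\<And>v. v \<bullet> (C *v v) \<le> c * (v \<bullet> v)" and "c > 0"
  shows "norm (C *v v) \<le> c * norm v"
proof -
  define u where "u = C *v v"
  have sym: "transpose C = C"
    using C by (simp add: psd_def)
  have cross: "v \<bullet> (C *v u) = u \<bullet> u"
    using inner_symmetric_matrix [OF sym, of v u] by (simp add: u_def)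
  \<comment> \<open>evaluating the form at the vector \<open>c v - C v\<close> replaces the Cauchy--Schwarz inequality for it\<close>
  have "0 \<le> (c *\<^sub>R v - u) \<bullet> (C *v (c *\<^sub>R v - u))"
    using C by (simp add: psd_def)
  also have "\<dots> = c * c * (v \<bullet> u) - 2 * c * (u \<bullet> u) + u \<bullet> (C *v u)"
    by (simp add: algebra_simps inner_diff_left inner_diff_right cross u_def [symmetric] inner_commute)
  also have "\<dots> \<le> c * c * (v \<bullet> u) - 2 * c * (u \<bullet> u) + c * (u \<bullet> u)"
    using c [of u] by simp
  finally have "c * (u \<bullet> u) \<le> c * (c * (v \<bullet> u))"
    by (simp add: algebra_simps)
  then have "u \<bullet> u \<le> c * (v \<bullet> u)"
    using \<open>c > 0\<close> by simp
  also have "\<dots> \<le> c * (c * (v \<bullet> v))"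
    using c [of v] \<open>c > 0\<close> by (simp add: u_def)
  finally have "(norm u)\<^sup>2 \<le> (c * norm v)\<^sup>2"
    by (simp add: power2_norm_eq_inner power_mult_distrib) (simp add: power2_eq_square)
  then show ?thesis
    unfolding u_def [symmetric] by (rule power2_le_imp_le) (use \<open>c > 0\<close> in simp)
qed

text \<open>
  After scaling, \<open>A = M (I - C)\<close> where \<open>C\<close> has operator norm at most some \<open>c < 1\<close>. A root of the
  form \<open>sqrt M (I - Z)\<close> amounts to a fixed point \<open>Z = (C + Z\<^sup>2) / 2\<close>. On the symmetric matrices of
  operator norm at most \<open>r = 1 - sqrt (1 - c)\<close> this map is a contraction with factor \<open>r\<close> in the
  Frobenius norm, so Banach's theorem applies and no spectral decomposition is involved. The same
  bound on \<open>Z\<close> makes the root positive definite.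
\<close>

lemma pos_def_root_exists:
  fixes A :: "real ^ 'n ^ 'n"
  assumes "pos_def A"
  obtains B where "pos_def B" and "B ** B = A"
proof -
  obtain \<alpha> where "\<alpha> > 0" and sym: "transpose A = A" and \<alpha>: "\<And>v. \<alpha> * (v \<bullet> v) \<le> v \<bullet> (A *v v)"
    using assms unfolding pos_def_def by blast
  obtain M0 where M0: "\<And>v. norm (A *v v) \<le> norm v * M0"
    using bounded_linear.bounded [OF linear_conv_bounded_linear [THEN iffD1, OF matrix_vector_mul_linear]]
    by metis
  define M where "M = \<bar>M0\<bar> + \<alpha> + 1"
  have M: "M > 0" "\<alpha> < M"
    using \<open>\<alpha> > 0\<close> by (simp_all add: M_def)
  have AM: "v \<bullet> (A *v v) \<le> M * (v \<bullet> v)" for v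
  proof -
    have "v \<bullet> (A *v v) \<le> norm v * (norm v * M0)"
      using norm_cauchy_schwarz [of v "A *v v"] M0 [of v]
      by (meson mult_left_mono norm_ge_zero order_trans)
    also have "\<dots> = M0 * (v \<bullet> v)"
      by (simp add: power2_norm_eq_inner [symmetric] power2_eq_square)
    also have "\<dots> \<le> M * (v \<bullet> v)"
      using \<open>\<alpha> > 0\<close> by (intro mult_right_mono) (auto simp: M_def)
    finally show ?thesis .
  qed
  define C where "C = mat 1 - (1 / M) *\<^sub>R A"
  define c where "c = 1 - \<alpha> / M"
  define r where "r = 1 - sqrt (\<alpha> / M)"
  have c: "0 < c" "c < 1"
    using M \<open>\<alpha> > 0\<close> by (simp_all add: c_def)
  have "sqrt (\<alpha> / M) < 1" "sqrt (\<alpha> / M) > 0"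
    using M \<open>\<alpha> > 0\<close> by simp_all
  then have r: "0 \<le> r" "r < 1"
    by (simp_all add: r_def)
  \<comment> \<open>\<open>r\<close> is the smaller fixed point of the scalar recursion \<open>t \<mapsto> (c + t\<^sup>2) / 2\<close>\<close>
  have rc: "(c + r * r) / 2 = r"
  proof -
    have "sqrt (\<alpha> / M) * sqrt (\<alpha> / M) = \<alpha> / M"
      using M \<open>\<alpha> > 0\<close> by simp
    then show ?thesis
      unfolding c_def r_def right_diff_distrib left_diff_distrib by simp
  qed
  have Cform: "v \<bullet> (C *v v) = v \<bullet> v - (v \<bullet> (A *v v)) / M" for v
    by (simp add: C_def matrix_vector_mult_diff_rdistrib inner_diff_right scaleR_matrix_vector_assoc [symmetric])
  have symC: "transpose C = C"
    by (simp add: C_def transpose_diff transpose_scalar sym)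
  have "psd C"
    unfolding psd_def using symC AM M by (auto simp: Cform field_simps)
  moreover have "v \<bullet> (C *v v) \<le> c * (v \<bullet> v)" for v
    using \<alpha> [of v] M by (simp add: Cform c_def field_simps)
  ultimately have Cnorm: "norm (C *v v) \<le> c * norm v" for v
    using c(1) by (rule psd_norm_le)
  define Y where "Y = {Y :: real^'n^'n. transpose Y = Y \<and> (\<forall>v. norm (Y *v v) \<le> r * norm v)}"
  define T where "T Z = (1/2) *\<^sub>R (C + Z ** Z)" for Z
  have "closed Y"
  proof -
    have c1: "continuous_on UNIV (transpose :: real^'n^'n \<Rightarrow> real^'n^'n)"
      by (intro linear_continuous_on linear_conv_bounded_linear [THEN iffD1] linear_transpose)
    have "linear (\<lambda>Z. Z *v v)" for v :: "real^'n"
      by (auto intro!: linearI simp: matrix_vector_mult_add_rdistrib scaleR_matrix_vector_assoc)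
    then have c2: "continuous_on UNIV (\<lambda>Z :: real^'n^'n. Z *v v)" for v :: "real^'n"
      by (intro linear_continuous_on linear_conv_bounded_linear [THEN iffD1])
    show ?thesis
      unfolding Y_def
      by (intro closed_Collect_conj closed_Collect_all closed_Collect_eq closed_Collect_le
          continuous_intros c1 c2)
  qed
  moreover have "0 \<in> Y"
    using r by (simp add: Y_def vec_eq_iff transpose_def)
  moreover have "T Z \<in> Y" if "Z \<in> Y" for Z
  proof -
    have Z: "transpose Z = Z" "\<And>v. norm (Z *v v) \<le> r * norm v"
      using that by (auto simp: Y_def)
    have "norm (T Z *v v) \<le> r * norm v" for v
    proof -
      have "norm (Z *v (Z *v v)) \<le> r * (r * norm v)"
        using Z(2) [of "Z *v v"] Z(2) [of v] r by (meson mult_left_mono order_trans)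
      moreover have "T Z *v v = (1/2) *\<^sub>R (C *v v + Z *v (Z *v v))"
        by (simp add: T_def scaleR_matrix_vector_assoc [symmetric] matrix_vector_mult_add_rdistrib matrix_vector_mul_assoc)
      ultimately have "norm (T Z *v v) \<le> (c * norm v + r * (r * norm v)) / 2"
        using Cnorm [of v] norm_triangle_ineq [of "C *v v" "Z *v (Z *v v)"] by simp
      also have "\<dots> = (c + r * r) / 2 * norm v"
        by (simp add: algebra_simps)
      finally show ?thesis
        unfolding rc .
    qed
    then show ?thesis
      by (simp add: Y_def T_def transpose_scalar transpose_add symC matrix_transpose_mul Z)
  qed
  moreover have "dist (T Z) (T W) \<le> r * dist Z W" if "Z \<in> Y" "W \<in> Y" for Z W
  proof -
    have Z: "transpose Z = Z" "\<And>v. norm (Z *v v) \<le> r * norm v"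
      and W: "transpose W = W" "\<And>v. norm (W *v v) \<le> r * norm v"
      using that by (auto simp: Y_def)
    have D: "transpose (Z - W) = Z - W"
      by (simp add: transpose_diff Z W)
    have "norm (Z ** (Z - W)) = norm ((Z - W) ** Z)"
      using norm_transpose [of "(Z - W) ** Z"] by (simp add: matrix_transpose_mul Z D)
    also have "\<dots> \<le> r * norm (Z - W)"
      using norm_matrix_mult_le [of Z r] Z r by simp
    finally have 1: "norm (Z ** (Z - W)) \<le> r * norm (Z - W)" .
    have 2: "norm ((Z - W) ** W) \<le> r * norm (Z - W)"
      using norm_matrix_mult_le [of W r] W r by simp
    have "T Z - T W = (1/2) *\<^sub>R (Z ** (Z - W) + (Z - W) ** W)"
      by (simp add: T_def matrix_mult.diff_left matrix_mult.diff_right algebra_simps)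
    then have "norm (T Z - T W) \<le> (norm (Z ** (Z - W)) + norm ((Z - W) ** W)) / 2"
      using norm_triangle_ineq [of "Z ** (Z - W)" "(Z - W) ** W"] by simp
    then show ?thesis
      using 1 2 by (simp add: dist_norm)
  qed
  ultimately obtain Z where "Z \<in> Y" and TZ: "T Z = Z"
    using Banach_fix [of Y r T] r complete_eq_closed by (metis empty_iff image_subsetI)
  define B where "B = sqrt M *\<^sub>R (mat 1 - Z)"
  have Z: "transpose Z = Z" "\<And>v. norm (Z *v v) \<le> r * norm v"
    using \<open>Z \<in> Y\<close> by (auto simp: Y_def)
  have "B ** B = M *\<^sub>R (mat 1 - 2 *\<^sub>R Z + Z ** Z)"
    using M by (simp add: B_def matrix_mult.diff_left matrix_mult.diff_right matrix_mult.scaleR_left matrix_mult.scaleR_right algebra_simps scaleR_2)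
  also have "2 *\<^sub>R Z = C + Z ** Z"
    by (subst TZ [symmetric]) (simp add: T_def)
  also have "M *\<^sub>R (mat 1 - (C + Z ** Z) + Z ** Z) = A"
    using M by (simp add: C_def)
  finally have BB: "B ** B = A" .
  have "pos_def B"
  proof (rule pos_defI)
    show "transpose B = B"
      by (simp add: B_def transpose_scalar transpose_diff Z)
    show "0 < sqrt M * (1 - r)"
      using M r by simp
    fix v
    have "v \<bullet> (Z *v v) \<le> norm v * (r * norm v)"
      using norm_cauchy_schwarz [of v "Z *v v"] Z(2) [of v]
      by (meson mult_left_mono norm_ge_zero order_trans)
    also have "\<dots> = r * (v \<bullet> v)"
      by (simp add: power2_norm_eq_inner [symmetric] power2_eq_square)
    finally have "sqrt M * ((1 - r) * (v \<bullet> v)) \<le> sqrt M * (v \<bullet> v - v \<bullet> (Z *v v))"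
      using M by (intro mult_left_mono) (simp_all add: algebra_simps)
    then show "sqrt M * (1 - r) * (v \<bullet> v) \<le> v \<bullet> (B *v v)"
      by (simp add: B_def scaleR_matrix_vector_assoc [symmetric] matrix_vector_mult_diff_rdistrib
          inner_diff_right)
  qed
  then show ?thesis
    using BB that by blast
qed

lemma psd_root_unique:
  assumes "pos_def B" and "psd C" and "C ** C = B ** B"
  shows "C = B"
proof -
  obtain \<beta> where "\<beta> > 0" and "transpose B = B" and "\<And>v. \<beta> * (v \<bullet> v) \<le> v \<bullet> (B *v v)"
    using assms(1) unfolding pos_def_def by blast
  then have "\<beta> * norm (B - C) \<le> 0"
    using psd_root_lipschitz [of B \<beta> C] assms by simp
  then show ?thesis
    using \<open>\<beta> > 0\<close> by (simp add: mult_le_0_iff)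
qed

lemma psd_sqrt_eqI:
  assumes "pos_def B" and "B ** B = A"
  shows "psd_sqrt A = B"
  unfolding psd_sqrt_def
  using assms pos_def_imp_psd psd_root_unique by (intro the_equality) auto

lemma pos_def_psd_sqrt:
  assumes "pos_def A"
  shows "pos_def (psd_sqrt A)" and "psd_sqrt A ** psd_sqrt A = A"
  using pos_def_root_exists [OF assms] psd_sqrt_eqI by metis+

lemma continuous_on_psd_sqrt: "continuous_on (Collect pos_def) psd_sqrt"
  unfolding continuous_on_iff
proof (intro ballI allI impI)
  fix A :: "real^'n^'n" and e :: real
  assume A: "A \<in> Collect pos_def" and "e > 0"
  define B where "B = psd_sqrt A"
  have "pos_def B" and BB: "B ** B = A"
    using A pos_def_psd_sqrt by (auto simp: B_def)
  then obtain \<beta> where "\<beta> > 0" and \<beta>: "transpose B = B" "\<And>v. \<beta> * (v \<bullet> v) \<le> v \<bullet> (B *v v)"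
    unfolding pos_def_def by blast
  have "dist (psd_sqrt A') B < e" if "A' \<in> Collect pos_def" "dist A' A < \<beta> * e" for A'
  proof -
    have "\<beta> * norm (B - psd_sqrt A') \<le> norm (A - A')"
      using psd_root_lipschitz [OF \<beta>, of "psd_sqrt A'"] that pos_def_psd_sqrt [of A']
      by (simp add: pos_def_imp_psd BB)
    then have "\<beta> * dist (psd_sqrt A') B < \<beta> * e"
      using that(2) by (simp add: dist_norm norm_minus_commute)
    then show ?thesis
      using \<open>\<beta> > 0\<close> by simp
  qed
  then show "\<exists>d>0. \<forall>A'\<in>Collect pos_def. dist A' A < d \<longrightarrow> dist (psd_sqrt A') (psd_sqrt A) < e"
    using \<open>\<beta> > 0\<close> \<open>e > 0\<close> unfolding B_def by (intro exI [of _ "\<beta> * e"]) simp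
qed

text \<open>
  Keeps the inner matrix of the Bures--Wasserstein formula in the domain where the square root
  is known to be continuous.
\<close>

lemma pos_def_congruence:
  fixes R Q :: "real ^ 'n ^ 'n"
  assumes "pos_def R" and "pos_def Q"
  shows "pos_def (R ** Q ** R)"
proof -
  obtain \<alpha> where "\<alpha> > 0" and symQ: "transpose Q = Q" and \<alpha>: "\<And>v. \<alpha> * (v \<bullet> v) \<le> v \<bullet> (Q *v v)"
    using assms(2) unfolding pos_def_def by blast
  obtain \<beta> where "\<beta> > 0" and symR: "transpose R = R" and \<beta>: "\<And>v. \<beta> * (v \<bullet> v) \<le> v \<bullet> (R *v v)"
    using assms(1) unfolding pos_def_def by blast
  have "\<alpha> * \<beta>\<^sup>2 * (v \<bullet> v) \<le> v \<bullet> ((R ** Q ** R) *v v)" for v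
  proof -
    have "norm v * (\<beta> * norm v) \<le> norm v * norm (R *v v)"
      using \<beta> [of v] norm_cauchy_schwarz [of v "R *v v"]
      by (simp add: power2_norm_eq_inner [symmetric] power2_eq_square algebra_simps)
    then have "\<beta> * norm v \<le> norm (R *v v)"
      by (cases "v = 0") auto
    then have "(\<beta> * norm v)\<^sup>2 \<le> (norm (R *v v))\<^sup>2"
      using \<open>\<beta> > 0\<close> by (intro power_mono) auto
    then have "\<alpha> * (\<beta>\<^sup>2 * (v \<bullet> v)) \<le> \<alpha> * ((R *v v) \<bullet> (R *v v))"
      using \<open>\<alpha> > 0\<close> by (simp add: power_mult_distrib power2_norm_eq_inner)
    also have "\<dots> \<le> (R *v v) \<bullet> (Q *v (R *v v))"
      by (rule \<alpha>)
    also have "\<dots> = v \<bullet> ((R ** Q ** R) *v v)"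
      by (simp add: inner_symmetric_matrix [OF symR] matrix_vector_mul_assoc matrix_mul_assoc)
    finally show ?thesis
      by simp
  qed
  then show ?thesis
    using \<open>\<alpha> > 0\<close> \<open>\<beta> > 0\<close>
    by (intro pos_defI [of _ "\<alpha> * \<beta>\<^sup>2"]) (simp_all add: matrix_transpose_mul symR symQ matrix_mul_assoc)
qed

section \<open>Continuity of the Bures--Wasserstein cost and of the objective\<close>

lemma sym_mats_ge_form:
  assumes "Q \<in> sym_mats_ge \<delta>"
  shows "\<delta> * (v \<bullet> v) \<le> v \<bullet> (Q *v v)"
proof -
  have "0 \<le> v \<bullet> ((Q - \<delta> *\<^sub>R mat 1) *v v)"
    using assms by (simp add: sym_mats_ge_def psd_def)
  then show ?thesis
    by (simp add: matrix_vector_mult_diff_rdistrib inner_diff_right scaleR_matrix_vector_assoc [symmetric])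
qed

lemma sym_mats_ge_pos_def:
  assumes "\<delta> > 0" and "Q \<in> sym_mats_ge \<delta>"
  shows "pos_def Q"
  using assms sym_mats_ge_form by (intro pos_defI [of _ \<delta>]) (auto simp: sym_mats_ge_def)

lemma bw_sq_self:
  assumes "pos_def (snd s)"
  shows "bw_sq s s = 0"
proof -
  define Q where "Q = snd s"
  define R where "R = psd_sqrt Q"
  have RR: "R ** R = Q"
    using pos_def_psd_sqrt assms by (simp add: R_def Q_def)
  have "(R ** Q) ** R = (R ** R) ** (R ** R)"
    unfolding RR [symmetric] by (simp only: matrix_mul_assoc)
  then have "psd_sqrt (R ** Q ** R) = Q"
    using assms by (intro psd_sqrt_eqI) (simp_all add: RR Q_def)
  then show ?thesis
    by (simp add: bw_sq_def case_prod_beta Q_def [symmetric] R_def [symmetric] scaleR_2 trace_def)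
qed

text \<open>
  Jointly in both arguments: continuity in the second one makes the attainable set in the duality
  argument compact, and the joint version makes the cost measurable on the product.
\<close>

lemma continuous_on_bw_sq:
  fixes S :: "'n::finite gauss_param set"
  assumes "\<And>s. s \<in> S \<Longrightarrow> pos_def (snd s)"
  shows "continuous_on (S \<times> S) (\<lambda>(s', s). bw_sq s' s)"
proof -
  define R where "R z = psd_sqrt (snd (fst z))"
    for z :: "'n gauss_param \<times> 'n gauss_param"
  have R: "continuous_on (S \<times> S) R"
    unfolding R_def using assms
    by (intro continuous_on_compose2 [OF continuous_on_psd_sqrt] continuous_intros) auto
  have "continuous_on (S \<times> S) (\<lambda>z. R z ** snd (snd z) ** R z)"
    by (intro matrix_mult.continuous_on R continuous_intros)
  moreover have "(\<lambda>z. R z ** snd (snd z) ** R z) ` (S \<times> S) \<subseteq> Collect pos_def"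
    unfolding R_def using assms by (auto intro!: pos_def_congruence pos_def_psd_sqrt)
  ultimately have "continuous_on (S \<times> S) (\<lambda>z. psd_sqrt (R z ** snd (snd z) ** R z))"
    using continuous_on_compose2 [OF continuous_on_psd_sqrt] by blast
  then show ?thesis
    unfolding bw_sq_def case_prod_beta trace_def R_def by (intro continuous_intros)
qed

lemma continuous_on_std_normal_cdf: "continuous_on UNIV std_normal_cdf"
proof -
  interpret real_distribution std_normal_distribution
    by (rule real_dist_normal_dist)
  have "measure std_normal_distribution {t} = 0" for t
    by (simp add: Sigma_Algebra.measure_def emeasure_density nn_integral_null_set null_setsI)
  then show ?thesis
    unfolding std_normal_cdf_def by (simp add: continuous_on_eq_continuous_at isCont_cdf)
qed

text \<open>
  The variance \<open>x \<bullet> (Q *v x)\<close> stays positive for \<open>x \<noteq> 0\<close>, so the quotient inside the distribution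
  function is continuous; for \<open>x = 0\<close> the function is constant.
\<close>

lemma continuous_on_G:
  fixes S :: "'n::finite gauss_param set"
  assumes "\<And>s. s \<in> S \<Longrightarrow> pos_def (snd s)"
  shows "continuous_on S (\<lambda>s. G b s x)"
proof (cases "x = 0")
  case False
  have pos: "x \<bullet> (snd s *v x) > 0" if s: "s \<in> S" for s
  proof -
    obtain \<alpha> where "\<alpha> > 0" and "\<And>v. \<alpha> * (v \<bullet> v) \<le> v \<bullet> (snd s *v v)"
      using assms [OF s] unfolding pos_def_def by blast
    then show ?thesis
      using False by (meson inner_gt_zero_iff less_le_trans mult_pos_pos)
  qed
  have "linear (\<lambda>Q :: real^'n^'n. Q *v x)"
    by (auto intro!: linearI simp: matrix_vector_mult_add_rdistrib scaleR_matrix_vector_assoc)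
  then have c2: "continuous_on UNIV (\<lambda>Q :: real^'n^'n. Q *v x)"
    by (intro linear_continuous_on linear_conv_bounded_linear [THEN iffD1])
  have "continuous_on S (\<lambda>s. std_normal_cdf ((b - fst s \<bullet> x) / sqrt (x \<bullet> (snd s *v x))))"
    using pos
    by (intro continuous_on_compose2 [OF continuous_on_std_normal_cdf] continuous_intros
        continuous_on_compose2 [OF c2]) (auto dest: pos)
  then show ?thesis
    using False by (simp add: G_def case_prod_beta)
qed (simp add: G_def case_prod_beta)

section \<open>Minkowski sums and multipliers in the plane\<close>

lemma compact_sum_selections:
  fixes A :: "'i \<Rightarrow> 'a::real_normed_vector set"
  assumes "finite I" and "\<And>k. k \<in> I \<Longrightarrow> compact (A k)"
  shows "compact {\<Sum>k\<in>I. f k | f. f \<in> Pi I A}"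
  using assms
proof (induction I)
  case empty
  show ?case by simp
next
  case (insert i I)
  have "{\<Sum>k\<in>insert i I. f k | f. f \<in> Pi (insert i I) A}
      = {a + y | a y. a \<in> A i \<and> y \<in> {\<Sum>k\<in>I. f k | f. f \<in> Pi I A}}" (is "?L = ?R")
  proof
    show "?L \<subseteq> ?R"
      using insert.hyps by fastforce
    show "?R \<subseteq> ?L"
    proof clarify
      fix a f
      assume "a \<in> A i" and "f \<in> Pi I A"
      then have "f(i := a) \<in> Pi (insert i I) A"
        by auto
      moreover have "(\<Sum>k\<in>insert i I. (f(i := a)) k) = a + (\<Sum>k\<in>I. f k)"
        using insert.hyps by (simp add: sum.insert) (rule sum.cong, auto)
      ultimately show "\<exists>f'. a + (\<Sum>k\<in>I. f k) = (\<Sum>k\<in>insert i I. f' k) \<and> f' \<in> Pi (insert i I) A"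
        by metis
    qed
  qed
  moreover have "compact ?R"
    using insert by (intro compact_sums) auto
  ultimately show ?case
    by (rule ssubst)
qed

text \<open>
  The quadrant of pairs at most \<open>(\<rho>, p)\<close> is closed and misses the compact convex hull of \<open>H\<close>, so a
  line separates the two strictly. Its coefficients are nonnegative because the quadrant is unbounded
  below. If the coefficient \<open>m\<close> of the second coordinate vanished, every point of the hull would have
  first coordinate above \<open>\<rho>\<close>, contrary to feasibility; dividing by \<open>m\<close> yields the multiplier. Strict
  separation from a compact set replaces a Slater point, so that the boundary case in which no point
  lies strictly below \<open>\<rho>\<close> is covered as well.
\<close>

lemma lagrange_multiplier_exists:
  fixes H :: "(real \<times> real) set" and \<rho> p :: real
  assumes "compact H"
    and feasible: "z\<^sub>0 \<in> convex hull H" "fst z\<^sub>0 \<le> \<rho>"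
    and above: "\<And>z. z \<in> convex hull H \<Longrightarrow> fst z \<le> \<rho> \<Longrightarrow> p < snd z"
  obtains l where "l \<ge> 0" and "\<And>z. z \<in> H \<Longrightarrow> p \<le> snd z + l * (fst z - \<rho>)"
proof -
  define T where "T = {..\<rho>} \<times> {..p}"
  have "convex hull H \<inter> T = {}"
    using above by (fastforce simp: T_def)
  moreover have "convex T" "closed T"
    by (simp_all add: T_def convex_Times closed_Times)
  moreover have "convex hull H \<noteq> {}"
    using feasible by auto
  ultimately obtain a t where sepH: "\<And>z. z \<in> convex hull H \<Longrightarrow> a \<bullet> z < t"
    and sepT: "\<And>z. z \<in> T \<Longrightarrow> t < a \<bullet> z"
    using separating_hyperplane_compact_closed
      [OF convex_convex_hull compact_convex_hull [OF \<open>compact H\<close>], of T] by metis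
  define l where "l = - fst a"
  define m where "m = - snd a"
  have T: "l * u + m * v < - t" if "u \<le> \<rho>" "v \<le> p" for u v
    using sepT [of "(u, v)"] that by (simp add: T_def l_def m_def inner_prod_def)
  have H: "- t < l * fst z + m * snd z" if "z \<in> convex hull H" for z
    using sepH [OF that] by (simp add: l_def m_def inner_prod_def)
  have T\<rho>p: "l * \<rho> + m * p < - t"
    by (rule T) auto
  \<comment> \<open>a negative coefficient would let one coordinate of a point of the quadrant decrease until the
    linear form reaches the separating value \<open>- t\<close>\<close>
  have "l \<ge> 0"
  proof (rule ccontr)
    assume "\<not> l \<ge> 0"
    then have "l * (\<rho> - (- t - l * \<rho> - m * p) / (- l)) + m * p = - t"
      by (simp add: field_simps)
    moreover have "(- t - l * \<rho> - m * p) / (- l) \<ge> 0"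
      using \<open>\<not> l \<ge> 0\<close> T\<rho>p by (intro divide_nonneg_pos) auto
    ultimately show False
      using T [of "\<rho> - (- t - l * \<rho> - m * p) / (- l)" p] by simp
  qed
  have "m \<ge> 0"
  proof (rule ccontr)
    assume "\<not> m \<ge> 0"
    then have "l * \<rho> + m * (p - (- t - l * \<rho> - m * p) / (- m)) = - t"
      by (simp add: field_simps)
    moreover have "(- t - l * \<rho> - m * p) / (- m) \<ge> 0"
      using \<open>\<not> m \<ge> 0\<close> T\<rho>p by (intro divide_nonneg_pos) auto
    ultimately show False
      using T [of \<rho> "p - (- t - l * \<rho> - m * p) / (- m)"] by simp
  qed
  have "m \<noteq> 0"
  proof
    assume "m = 0"
    then have "l * \<rho> < l * fst z\<^sub>0"
      using H [OF feasible(1)] T\<rho>p by simp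
    then show False
      using \<open>l \<ge> 0\<close> feasible(2) by (simp add: mult_left_mono leD)
  qed
  with \<open>m \<ge> 0\<close> have "m > 0"
    by simp
  have "p \<le> snd z + l / m * (fst z - \<rho>)" if "z \<in> H" for z
  proof -
    have "l * \<rho> + m * p < l * fst z + m * snd z"
      using H [OF hull_inc [OF that]] T\<rho>p by simp
    then show ?thesis
      using \<open>m > 0\<close> by (simp add: field_simps)
  qed
  then show ?thesis
    using that [of "l / m"] \<open>l \<ge> 0\<close> \<open>m > 0\<close> by simp
qed

section \<open>Slices of a coupling and weak duality\<close>

lemma fibre_measurable:
  assumes "sets \<pi> = sets (restrict_space borel (T \<times> S))" and "closed S" and "s' \<in> T"
  shows "{s'} \<times> S \<in> sets (\<pi> :: ('n::finite gauss_param \<times> 'n gauss_param) measure)"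
proof -
  have "{s'} \<times> S \<in> sets borel"
    using assms by (intro borel_closed closed_Times) auto
  moreover have "{s'} \<times> S = (T \<times> S) \<inter> ({s'} \<times> S)"
    using assms by auto
  ultimately show ?thesis
    unfolding assms(1) sets_restrict_space by (metis imageI)
qed

lemma integral_slice:
  fixes h :: "'n::finite gauss_param \<Rightarrow> real"
  assumes sets: "sets \<pi> = sets (restrict_space borel (T \<times> S))" and "closed S" and "s' \<in> T"
    and h: "h \<in> borel_measurable (restrict_space borel S)"
  shows "(\<integral>s. h s \<partial>slice \<pi> S s') = (\<integral>z. indicator ({s'} \<times> S) z * h (snd z) \<partial>\<pi>)"
proof -
  have fib: "{s'} \<times> S \<in> sets \<pi>"
    using fibre_measurable assms by blast
  have "snd \<in> borel_measurable (restrict_space borel (T \<times> S))"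
    by (intro measurable_restrict_space1 borel_measurable_continuous_onI continuous_intros)
  then have "snd \<in> borel_measurable \<pi>"
    using measurable_cong_sets [OF sets refl] by blast
  then have snd: "snd \<in> measurable (restrict_space \<pi> ({s'} \<times> S)) (restrict_space borel S)"
    by (intro measurable_restrict_space2 measurable_restrict_space1) (auto simp: space_restrict_space)
  show ?thesis
    unfolding slice_def using fib h
    by (subst integral_distr [OF snd h]) (simp add: integral_restrict_space sets.Int)
qed

lemma integrable_snd:
  fixes h :: "'n::finite gauss_param \<Rightarrow> real"
  assumes "prob_space \<pi>" and sets: "sets \<pi> = sets (restrict_space borel (T \<times> S))"
    and "compact S" and h: "continuous_on S h"
  shows "integrable \<pi> (\<lambda>z. h (snd z))"
proof -
  interpret prob_space \<pi> by fact
  have space: "space \<pi> = T \<times> S"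
    using sets_eq_imp_space_eq [OF sets] by (simp add: space_restrict_space)
  have "bounded (h ` S)"
    using assms compact_continuous_image compact_imp_bounded by blast
  then obtain M where M: "\<And>s. s \<in> S \<Longrightarrow> norm (h s) \<le> M"
    by (auto simp: bounded_iff)
  have "continuous_on (T \<times> S) (\<lambda>z. h (snd z))"
    by (intro continuous_on_compose2 [OF h] continuous_intros) auto
  then have "(\<lambda>z. h (snd z)) \<in> borel_measurable \<pi>"
    using measurable_cong_sets [OF sets refl] borel_measurable_continuous_on_restrict by blast
  moreover have "AE z in \<pi>. norm (h (snd z)) \<le> M"
    by (rule AE_I2) (auto simp: space simp del: real_norm_def intro!: M)
  ultimately show ?thesis
    by (rule integrable_const_bound [rotated])
qed

lemma sum_fibre_indicator:
  fixes a :: "'i \<Rightarrow> real"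
  assumes "inj_on sh I" and "finite I" and "j \<in> I" and "s \<in> S"
  shows "(\<Sum>k\<in>I. indicator ({sh k} \<times> S) (sh j, s) * a k) = a j"
proof -
  have "indicator ({sh k} \<times> S) (sh j, s) * a k = (if k = j then a j else 0)" if "k \<in> I" for k
    using inj_on_eq_iff [OF \<open>inj_on sh I\<close> \<open>j \<in> I\<close> that] \<open>s \<in> S\<close> by (auto simp: indicator_def)
  then show ?thesis
    using \<open>finite I\<close> \<open>j \<in> I\<close> by simp
qed

text \<open>
  The fibres over the distinct points \<open>sh k\<close> partition the product, so the slices together recover
  the integral against the coupling itself.
\<close>

lemma sum_integral_slices:
  fixes h :: "'n::finite gauss_param \<Rightarrow> real"
  assumes "prob_space \<pi>" and sets: "sets \<pi> = sets (restrict_space borel (sh ` I \<times> S))"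
    and "finite I" and "inj_on sh I"
    and "compact S" and h: "continuous_on S h"
  shows "(\<Sum>k\<in>I. \<integral>s. h s \<partial>slice \<pi> S (sh k)) = (\<integral>z. h (snd z) \<partial>\<pi>)"
proof -
  have space: "space \<pi> = sh ` I \<times> S"
    using sets_eq_imp_space_eq [OF sets] by (simp add: space_restrict_space)
  have "(\<Sum>k\<in>I. \<integral>s. h s \<partial>slice \<pi> S (sh k)) = (\<Sum>k\<in>I. \<integral>z. indicator ({sh k} \<times> S) z * h (snd z) \<partial>\<pi>)"
    using assms compact_imp_closed borel_measurable_continuous_on_restrict
    by (intro sum.cong integral_slice) auto
  also have "\<dots> = (\<integral>z. (\<Sum>k\<in>I. indicator ({sh k} \<times> S) z * h (snd z)) \<partial>\<pi>)"
  proof (rule Bochner_Integration.integral_sum [symmetric])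
    fix k
    assume "k \<in> I"
    then have "{sh k} \<times> S \<in> sets \<pi>"
      using fibre_measurable [OF sets compact_imp_closed [OF \<open>compact S\<close>]] by blast
    then show "integrable \<pi> (\<lambda>z. indicator ({sh k} \<times> S) z * h (snd z))"
      using integrable_mult_indicator [OF _ integrable_snd [OF assms(1) sets \<open>compact S\<close> h]] by simp
  qed
  also have "\<dots> = (\<integral>z. h (snd z) \<partial>\<pi>)"
  proof (rule Bochner_Integration.integral_cong [OF refl])
    fix z
    assume "z \<in> space \<pi>"
    then obtain j s where z: "z = (sh j, s)" "j \<in> I" "s \<in> S"
      by (auto simp: space)
    show "(\<Sum>k\<in>I. indicator ({sh k} \<times> S) z * h (snd z)) = h (snd z)"
      unfolding z(1) by (rule sum_fibre_indicator [OF \<open>inj_on sh I\<close> \<open>finite I\<close> z(2,3)])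
  qed
  finally show ?thesis .
qed

text \<open>
  A dual point defines the function equal to \<open>\<beta> k\<close> on the fibre over \<open>sh k\<close>; its integral depends on the
  marginals only. Integrating the dual constraint against \<open>\<pi>\<close> and using the budget gives the claim.
\<close>

lemma weak_duality:
  assumes "compact S" and "inj_on sh {1..K}"
    and G: "continuous_on S (\<lambda>s. G b s x)"
    and \<pi>: "\<pi> \<in> couplings S K sh w \<rho>" and \<beta>: "\<beta> \<in> dual_feasible S K sh b x"
  shows "dual_obj K w \<rho> \<beta> \<le> primal_obj S K sh b x \<pi>"
proof -
  interpret prob_space \<pi>
    using \<pi> by (simp add: couplings_def)
  define c where "c z = bw_sq (fst z) (snd z)" for z :: "'a gauss_param \<times> 'a gauss_param"
  define B where "B z = (\<Sum>k=1..K. indicator ({sh k} \<times> S) z * \<beta> k)" for z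
  have sets: "sets \<pi> = sets (restrict_space borel (sh ` {1..K} \<times> S))"
    and w: "\<And>k. k \<in> {1..K} \<Longrightarrow> measure \<pi> ({sh k} \<times> S) = w k"
    and c: "integrable \<pi> c" "(\<integral>z. c z \<partial>\<pi>) \<le> \<rho>"
    using \<pi> by (auto simp: couplings_def c_def [abs_def] case_prod_unfold)
  have \<beta>0: "\<beta> (K+1) \<ge> 0" and dual: "\<And>k s. k \<in> {1..K} \<Longrightarrow> s \<in> S \<Longrightarrow> \<beta> k - \<beta> (K+1) * bw_sq (sh k) s \<le> G b s x"
    using \<beta> by (auto simp: dual_feasible_def)
  have space: "space \<pi> = sh ` {1..K} \<times> S"
    using sets_eq_imp_space_eq [OF sets] by (simp add: space_restrict_space)
  have fib: "{sh k} \<times> S \<in> events" if "k \<in> {1..K}" for k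
    using fibre_measurable [OF sets compact_imp_closed [OF \<open>compact S\<close>]] that by blast
  have iB: "integrable \<pi> B"
    unfolding B_def using fib
    by (intro Bochner_Integration.integrable_sum integrable_mult_left integrable_real_indicator)
      (auto simp: emeasure_eq_measure)
  have "(\<integral>z. B z \<partial>\<pi>) = (\<Sum>k=1..K. \<integral>z. indicator ({sh k} \<times> S) z * \<beta> k \<partial>\<pi>)"
    unfolding B_def using fib
    by (intro Bochner_Integration.integral_sum integrable_mult_left integrable_real_indicator)
      (auto simp: emeasure_eq_measure)
  also have "\<dots> = (\<Sum>k=1..K. w k * \<beta> k)"
    using fib w sets.sets_into_space by (intro sum.cong) (simp_all add: Int_absorb2)
  finally have "dual_obj K w \<rho> \<beta> = (\<integral>z. B z \<partial>\<pi>) - \<rho> * \<beta> (K+1)"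
    by (simp add: dual_obj_def)
  also have "\<dots> \<le> (\<integral>z. B z \<partial>\<pi>) - \<beta> (K+1) * (\<integral>z. c z \<partial>\<pi>)"
    using mult_left_mono [OF c(2) \<beta>0] by (simp add: mult.commute)
  also have "\<dots> = (\<integral>z. B z - \<beta> (K+1) * c z \<partial>\<pi>)"
    using iB c(1) by simp
  also have "\<dots> \<le> (\<integral>z. G b (snd z) x \<partial>\<pi>)"
  proof (rule integral_mono)
    show "integrable \<pi> (\<lambda>z. B z - \<beta> (K+1) * c z)"
      using iB c(1) by simp
    show "integrable \<pi> (\<lambda>z. G b (snd z) x)"
      using integrable_snd [OF prob_space_axioms sets \<open>compact S\<close> G] .
    fix z
    assume "z \<in> space \<pi>"
    then obtain j s where z: "z = (sh j, s)" "j \<in> {1..K}" "s \<in> S"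
      by (auto simp: space)
    have "B z = \<beta> j"
      unfolding B_def z(1) by (rule sum_fibre_indicator [OF assms(2) _ z(2,3)]) simp
    then show "B z - \<beta> (K+1) * c z \<le> G b (snd z) x"
      using dual [of j s] z by (simp add: c_def)
  qed
  also have "\<dots> = primal_obj S K sh b x \<pi>"
    unfolding primal_obj_def
    using sum_integral_slices [OF prob_space_axioms sets _ assms(2,1) G] by simp
  finally show ?thesis .
qed

section \<open>Strong duality through the attainable moments\<close>

text \<open>
  The pairs (transport cost, objective) of the couplings that move each nominal component as a whole
  to a single place \<open>f k\<close>. Splitting the mass of the components corresponds to convex combinations.
\<close>

definition moments ::
  "'n::finite gauss_param set \<Rightarrow> nat \<Rightarrow> (nat \<Rightarrow> 'n gauss_param) \<Rightarrow> (nat \<Rightarrow> real) \<Rightarrow> real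
   \<Rightarrow> real ^ 'n \<Rightarrow> (real \<times> real) set" where
  "moments S K sh w b x =
     {\<Sum>k=1..K. w k *\<^sub>R (bw_sq (sh k) (f k), G b (f k) x) | f. f \<in> {1..K} \<rightarrow> S}"

text \<open>
  A convex combination of finitely many assignments \<open>F j\<close> with coefficients \<open>u j\<close> is realised by the
  coupling that puts mass \<open>u j * w k\<close> on the pair of \<open>sh k\<close> and \<open>F j k\<close>. Hence finitely supported couplings
  already fill the convex hull.
\<close>

lemma coupling_of_moment:
  assumes "compact S" and inj: "inj_on sh {1..K}"
    and w: "\<And>k. k \<in> {1..K} \<Longrightarrow> w k \<ge> 0" "(\<Sum>k=1..K. w k) = 1"
    and sh: "\<And>k. k \<in> {1..K} \<Longrightarrow> sh k \<in> S"
    and c: "continuous_on (S \<times> S) (\<lambda>(s', s). bw_sq s' s)"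
    and G: "continuous_on S (\<lambda>s. G b s x)"
    and z: "z \<in> convex hull moments S K sh w b x" "fst z \<le> \<rho>"
  obtains \<pi> where "\<pi> \<in> couplings S K sh w \<rho>" and "primal_obj S K sh b x \<pi> = snd z"
proof -
  obtain J u where J: "finite J" "J \<subseteq> moments S K sh w b x" "\<And>j. j \<in> J \<Longrightarrow> 0 \<le> u j" "sum u J = 1"
    and zJ: "(\<Sum>j\<in>J. u j *\<^sub>R j) = z"
    using z(1) unfolding convex_hull_explicit by blast
  have "\<forall>j\<in>J. \<exists>f. f \<in> {1..K} \<rightarrow> S \<and> j = (\<Sum>k=1..K. w k *\<^sub>R (bw_sq (sh k) (f k), G b (f k) x))"
    using J(2) unfolding moments_def by blast
  from bchoice [OF this] obtain F where F: "\<And>j. j \<in> J \<Longrightarrow> F j \<in> {1..K} \<rightarrow> S"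
    and Fj: "\<And>j. j \<in> J \<Longrightarrow> j = (\<Sum>k=1..K. w k *\<^sub>R (bw_sq (sh k) (F j k), G b (F j k) x))"
    by blast
  define N where "N = restrict_space borel (sh ` {1..K} \<times> S)"
  define P where "P = point_measure (J \<times> {1..K}) (\<lambda>jk. ennreal (u (fst jk) * w (snd jk)))"
  define e where "e jk = (sh (snd jk), F (fst jk) (snd jk))" for jk
  define \<pi> where "\<pi> = distr P N e"
  have fin: "finite (J \<times> {1..K})"
    using J by simp
  have uw: "0 \<le> u (fst jk) * w (snd jk)" if "jk \<in> J \<times> {1..K}" for jk
    using that J w by auto
  have total: "(\<Sum>jk\<in>J \<times> {1..K}. u (fst jk) * w (snd jk)) = 1"
    using J(4) w(2) by (simp add: sum.cartesian_product' sum_product [symmetric])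
  have "prob_space P"
    unfolding P_def
    by (rule prob_space_point_measure [OF fin])
      (use uw total in \<open>auto simp: sum_ennreal [symmetric]\<close>)
  have e: "e \<in> measurable P N"
    using F by (force simp: P_def N_def e_def space_restrict_space simp del: One_nat_def)
  have prob: "prob_space \<pi>"
    unfolding \<pi>_def using prob_space.prob_space_distr [OF \<open>prob_space P\<close> e] .
  have sets: "sets \<pi> = sets (restrict_space borel (sh ` {1..K} \<times> S))"
    by (simp add: \<pi>_def N_def)
  have space: "space \<pi> = sh ` {1..K} \<times> S"
    using sets_eq_imp_space_eq [OF sets] by (simp add: space_restrict_space)
  have integral: "(\<integral>y. h y \<partial>\<pi>) = (\<Sum>j\<in>J. u j * (\<Sum>k=1..K. w k * h (sh k, F j k)))"
    if h: "h \<in> borel_measurable N" for h :: "_ \<Rightarrow> real"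
  proof -
    have "(\<integral>y. h y \<partial>\<pi>) = (\<integral>jk. h (e jk) \<partial>P)"
      unfolding \<pi>_def by (rule integral_distr [OF e h])
    also have "\<dots> = (\<Sum>jk\<in>J \<times> {1..K}. (u (fst jk) * w (snd jk)) *\<^sub>R h (e jk))"
      unfolding P_def by (rule lebesgue_integral_point_measure_finite [OF fin uw])
    finally show ?thesis
      by (simp add: sum.cartesian_product' e_def sum_distrib_left mult.assoc)
  qed
  have c_cont: "continuous_on (sh ` {1..K} \<times> S) (\<lambda>y. bw_sq (fst y) (snd y))"
    by (rule continuous_on_subset [OF c [unfolded case_prod_unfold]]) (use sh in blast)
  then have cN: "(\<lambda>y. bw_sq (fst y) (snd y)) \<in> borel_measurable N"
    unfolding N_def by (rule borel_measurable_continuous_on_restrict)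
  have "continuous_on (sh ` {1..K} \<times> S) (\<lambda>y. G b (snd y) x)"
    by (intro continuous_on_compose2 [OF G] continuous_intros) auto
  then have GN: "(\<lambda>y. G b (snd y) x) \<in> borel_measurable N"
    unfolding N_def by (rule borel_measurable_continuous_on_restrict)
  have marginal: "measure \<pi> ({sh i} \<times> S) = w i" if i: "i \<in> {1..K}" for i
  proof -
    have fib: "{sh i} \<times> S \<in> sets \<pi>"
      using fibre_measurable [OF sets compact_imp_closed [OF \<open>compact S\<close>]] i by blast
    then have "measure \<pi> ({sh i} \<times> S) = (\<integral>y. indicator ({sh i} \<times> S) y \<partial>\<pi>)"
      using sets.sets_into_space [OF fib] by (simp add: Int_absorb2)
    also have "\<dots> = (\<Sum>j\<in>J. u j * (\<Sum>k=1..K. w k * indicator ({sh i} \<times> S) (sh k, F j k)))"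
      using fib by (intro integral borel_measurable_indicator) (simp add: \<pi>_def)
    also have "\<dots> = (\<Sum>j\<in>J. u j * (\<Sum>k=1..K. if k = i then w i else 0))"
    proof -
      have "w k * indicator ({sh i} \<times> S) (sh k, F j k) = (if k = i then w i else 0)"
        if "j \<in> J" "k \<in> {1..K}" for j k
        using inj_on_eq_iff [OF inj that(2) i] funcset_mem [OF F that(2)] that(1)
        by (auto simp: indicator_def)
      then show ?thesis
        by simp
    qed
    also have "\<dots> = w i"
      using i J by (simp add: sum_distrib_right [symmetric])
    finally show ?thesis .
  qed
  have "integrable P (\<lambda>jk. bw_sq (fst (e jk)) (snd (e jk)))"
    unfolding P_def by (rule integrable_point_measure_finite [OF fin])
  then have integrable: "integrable \<pi> (\<lambda>y. bw_sq (fst y) (snd y))"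
    unfolding \<pi>_def by (subst integrable_distr_eq [OF e cN])
  have "fst z = (\<Sum>j\<in>J. u j * fst j)"
    by (simp add: zJ [symmetric] fst_sum)
  also have "\<dots> = (\<Sum>j\<in>J. u j * (\<Sum>k=1..K. w k * bw_sq (sh k) (F j k)))"
    by (intro sum.cong arg_cong2 [where f = "(*)"] refl) (subst Fj, simp_all add: fst_sum)
  also have "\<dots> = (\<integral>y. bw_sq (fst y) (snd y) \<partial>\<pi>)"
    by (simp add: integral [OF cN])
  finally have "(\<integral>y. bw_sq (fst y) (snd y) \<partial>\<pi>) \<le> \<rho>"
    using z(2) by simp
  with prob sets marginal integrable have "\<pi> \<in> couplings S K sh w \<rho>"
    by (simp add: couplings_def case_prod_unfold)
  moreover have "primal_obj S K sh b x \<pi> = (\<integral>y. G b (snd y) x \<partial>\<pi>)"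
    unfolding primal_obj_def
    using sum_integral_slices [OF prob sets _ inj \<open>compact S\<close> G] by simp
  moreover have "\<dots> = (\<Sum>j\<in>J. u j * (\<Sum>k=1..K. w k * G b (F j k) x))"
    by (simp add: integral [OF GN])
  moreover have "\<dots> = (\<Sum>j\<in>J. u j * snd j)"
    by (intro sum.cong arg_cong2 [where f = "(*)"] refl) (subst (2) Fj, simp_all add: snd_sum)
  moreover have "\<dots> = snd z"
    by (simp add: zJ [symmetric] snd_sum)
  ultimately show ?thesis
    using that by simp
qed

text \<open>
  The moments form the Minkowski sum over \<open>k\<close> of continuous images of \<open>S\<close>.
\<close>

lemma compact_moments:
  assumes "compact S"
    and c: "\<And>k. k \<in> {1..K} \<Longrightarrow> continuous_on S (bw_sq (sh k))"
    and G: "continuous_on S (\<lambda>s. G b s x)"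
  shows "compact (moments S K sh w b x)"
proof -
  define A where "A k = (\<lambda>s. w k *\<^sub>R (bw_sq (sh k) s, G b s x)) ` S" for k
  have "compact (A k)" if "k \<in> {1..K}" for k
    unfolding A_def using that
    by (intro compact_continuous_image continuous_intros c G \<open>compact S\<close>)
  then have "compact {\<Sum>k\<in>{1..K}. f k | f. f \<in> Pi {1..K} A}"
    by (intro compact_sum_selections) auto
  also have "{\<Sum>k\<in>{1..K}. f k | f. f \<in> Pi {1..K} A} = moments S K sh w b x" (is "?L = _")
  proof
    show "moments S K sh w b x \<subseteq> ?L"
      unfolding moments_def A_def by blast
    show "?L \<subseteq> moments S K sh w b x"
    proof
      fix y
      assume "y \<in> ?L"
      then obtain f where y: "y = sum f {1..K}" and "f \<in> Pi {1..K} A"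
        by auto
      then have "\<forall>k\<in>{1..K}. \<exists>s\<in>S. f k = w k *\<^sub>R (bw_sq (sh k) s, G b s x)"
        unfolding A_def by blast
      then obtain t where "\<And>k. k \<in> {1..K} \<Longrightarrow> t k \<in> S"
        and ft: "\<And>k. k \<in> {1..K} \<Longrightarrow> f k = w k *\<^sub>R (bw_sq (sh k) (t k), G b (t k) x)"
        by metis
      moreover have "y = (\<Sum>k=1..K. w k *\<^sub>R (bw_sq (sh k) (t k), G b (t k) x))"
        unfolding y by (rule sum.cong [OF refl ft])
      ultimately show "y \<in> moments S K sh w b x"
        unfolding moments_def by blast
    qed
  qed
  finally show ?thesis .
qed

text \<open>
  For a fixed multiplier the best \<open>\<beta> k\<close> is the minimum over \<open>S\<close> of the penalised objective. Choosing a
  minimiser for every \<open>k\<close> gives one assignment, and the bound on the moments, applied to that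
  assignment, is exactly the bound on the dual objective.
\<close>

lemma dual_point_of_multiplier:
  assumes "compact S" and "S \<noteq> {}"
    and w: "\<And>k. k \<in> {1..K} \<Longrightarrow> w k \<ge> 0"
    and c: "\<And>k. k \<in> {1..K} \<Longrightarrow> continuous_on S (bw_sq (sh k))"
    and G: "continuous_on S (\<lambda>s. G b s x)"
    and "l \<ge> 0"
    and l: "\<And>z. z \<in> moments S K sh w b x \<Longrightarrow> p \<le> snd z + l * (fst z - \<rho>)"
  obtains \<beta> where "\<beta> \<in> dual_feasible S K sh b x" and "p \<le> dual_obj K w \<rho> \<beta>"
proof -
  have "\<exists>s\<in>S. \<forall>t\<in>S. G b s x + l * bw_sq (sh k) s \<le> G b t x + l * bw_sq (sh k) t"
    if "k \<in> {1..K}" for k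
    using that by (intro continuous_attains_inf \<open>compact S\<close> \<open>S \<noteq> {}\<close> continuous_intros c G)
  then obtain f where f: "\<And>k. k \<in> {1..K} \<Longrightarrow> f k \<in> S"
    and least: "\<And>k t. k \<in> {1..K} \<Longrightarrow> t \<in> S \<Longrightarrow>
      G b (f k) x + l * bw_sq (sh k) (f k) \<le> G b t x + l * bw_sq (sh k) t"
    by metis
  define \<beta> where "\<beta> = (\<lambda>k\<in>{1..K+1}. if k = K+1 then l else G b (f k) x + l * bw_sq (sh k) (f k))"
  have \<beta>K: "\<beta> (K+1) = l"
    by (simp add: \<beta>_def)
  have \<beta>: "\<beta> k = G b (f k) x + l * bw_sq (sh k) (f k)" if "k \<in> {1..K}" for k
    using that by (auto simp: \<beta>_def)
  have "\<beta> \<in> {1..K+1} \<rightarrow>\<^sub>E UNIV"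
    by (simp add: \<beta>_def)
  then have feasible: "\<beta> \<in> dual_feasible S K sh b x"
    unfolding dual_feasible_def using least \<open>l \<ge> 0\<close> by (simp add: \<beta>K[simplified] \<beta> algebra_simps)
  define z where "z = (\<Sum>k=1..K. w k *\<^sub>R (bw_sq (sh k) (f k), G b (f k) x))"
  have "z \<in> moments S K sh w b x"
    unfolding z_def moments_def using f by blast
  then have "p \<le> snd z + l * (fst z - \<rho>)"
    by (rule l)
  also have "\<dots> = (\<Sum>k=1..K. w k * \<beta> k) - \<rho> * l"
    by (simp add: z_def fst_sum snd_sum \<beta> sum.distrib sum_distrib_left algebra_simps)
  finally have "p \<le> dual_obj K w \<rho> \<beta>"
    unfolding dual_obj_def \<beta>K .
  with feasible show ?thesis
    using that by blast
qed

theorem lemma3: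
  fixes \<Theta> :: "(real ^ 'n) set"
    and \<Xi> :: "(real ^ 'n ^ 'n) set"
    and S :: "'n gauss_param set"
    and X :: "(real ^ 'n) set"
    and K :: nat
    and sh :: "nat \<Rightarrow> 'n gauss_param"
    and w :: "nat \<Rightarrow> real"
    and \<delta> b \<rho> :: real
    and x :: "real ^ 'n"
  assumes "\<delta> > 0"
    and "S = \<Theta> \<times> \<Xi>"
    and "\<Xi> \<subseteq> sym_mats_ge \<delta>"
    and "compact S"
    and "\<forall>k\<in>{1..K}. sh k \<in> S"
    and "inj_on sh {1..K}"
    and "\<forall>k\<in>{1..K}. w k \<ge> 0"
    and "(\<Sum>k=1..K. w k) = 1"
    and "compact X"
    and "\<rho> \<ge> 0"
    and "x \<in> X"
  shows "(INF \<pi>\<in>couplings S K sh w \<rho>. ereal (primal_obj S K sh b x \<pi>))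
       = (SUP \<beta>\<in>dual_feasible S K sh b x. ereal (dual_obj K w \<rho> \<beta>))"
    (is "?P = ?D")
proof (rule antisym)
  have pd: "pos_def (snd s)" if "s \<in> S" for s
  proof (rule sym_mats_ge_pos_def [OF \<open>\<delta> > 0\<close>])
    show "snd s \<in> sym_mats_ge \<delta>"
      using that assms(2,3) by auto
  qed
  have c: "continuous_on (S \<times> S) (\<lambda>(s', s). bw_sq s' s)"
    by (rule continuous_on_bw_sq [OF pd])
  have shS: "sh k \<in> S" and w0: "w k \<ge> 0" if "k \<in> {1..K}" for k
    using assms(5,7) that by blast+
  have ck: "continuous_on S (bw_sq (sh k))" if "k \<in> {1..K}" for k
  proof -
    have "continuous_on S (\<lambda>s. (sh k, s))"
      by (intro continuous_intros)
    moreover have "(\<lambda>s. (sh k, s)) ` S \<subseteq> S \<times> S"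
      using assms(5) that by auto
    ultimately show ?thesis
      using continuous_on_compose2 [OF c] by fastforce
  qed
  have G: "continuous_on S (\<lambda>s. G b s x)"
    by (rule continuous_on_G [OF pd])
  show "?D \<le> ?P"
    using weak_duality [OF assms(4,6) G] by (intro SUP_least INF_greatest) simp
  have "{1..K} \<noteq> {}"
    using assms(8) by fastforce
  then have "S \<noteq> {}"
    using assms(5) by blast
  show "?P \<le> ?D"
  proof (rule dense_le)
    \<comment> \<open>comparing with real numbers strictly below the primal value needs no attainment of either value\<close>
    fix q
    assume q: "q < ?P"
    show "q \<le> ?D"
    proof (cases q)
      case (real p)
      define H where "H = moments S K sh w b x"
      have above: "p < snd z" if z: "z \<in> convex hull H" "fst z \<le> \<rho>" for z
      proof -
        obtain \<pi> where "\<pi> \<in> couplings S K sh w \<rho>" "primal_obj S K sh b x \<pi> = snd z"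
          by (rule coupling_of_moment [OF assms(4,6) w0 assms(8) shS c G z [unfolded H_def]])
        then have "?P \<le> ereal (snd z)"
          by (metis INF_lower)
        with q have "q < ereal (snd z)"
          by (rule less_le_trans)
        then show ?thesis
          by (simp add: real)
      qed
      \<comment> \<open>leaving every nominal component in place costs nothing\<close>
      define z0 where "z0 = (\<Sum>k=1..K. w k *\<^sub>R (bw_sq (sh k) (sh k), G b (sh k) x))"
      have "z0 \<in> H"
        unfolding z0_def H_def moments_def using assms(5) by blast
      moreover have "fst z0 = 0"
        using bw_sq_self [OF pd [OF shS]] by (simp add: z0_def fst_sum)
      ultimately have z0: "z0 \<in> convex hull H" "fst z0 \<le> \<rho>"
        using \<open>\<rho> \<ge> 0\<close> by (simp_all add: hull_inc)
      have "compact H"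
        unfolding H_def by (rule compact_moments [OF assms(4) ck G])
      then obtain l where "l \<ge> 0"
        and l: "\<And>z. z \<in> H \<Longrightarrow> p \<le> snd z + l * (fst z - \<rho>)"
        using lagrange_multiplier_exists z0 above by blast
      obtain \<beta> where "\<beta> \<in> dual_feasible S K sh b x" "p \<le> dual_obj K w \<rho> \<beta>"
        by (rule dual_point_of_multiplier
            [OF assms(4) \<open>S \<noteq> {}\<close> w0 ck G \<open>l \<ge> 0\<close> l [unfolded H_def]])
      then show ?thesis
        unfolding real by (intro SUP_upper2) auto
    qed (use q in auto)
  qed
qed

end
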